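(* Let $\gamma>0$, let $D_+,D_-,M$ be a one-dimensional periodic upwind SBP operator with $\mathtt{ndof}$ degrees of freedom, let $D_2=D_\circ D_\diamond$ with either $(\circ,\diamond)=(+,-)$ or $(\circ,\diamond)=(-,+)$, and let $g(c)=\frac14(c^2-1)^2$. Define the discrete Cahn-Hilliard energy $$\mathcal E_d(c)=1^TM\,g(c)-\frac\gamma2\,c^TMD_2c,\qquad c\in\mathbb R^{\mathtt{ndof}},$$ where $1$ denotes the vector whose entries are all equal to unity. This energy is dissipative: for every solution $c=c(t)$ of the semidiscretization $$\partial_t c=D_2\big(g'(c)-\gamma D_2c\big)$$ one has $$\frac{\mathrm d}{\mathrm dt}\mathcal E_d(c)\le0.$$
   Context: Periodic upwind SBP operator (one space dimension): matrices $D_+,D_-\in\mathbb R^{\mathtt{ndof}\times\mathtt{ndof}}$ consistent with the first derivative (in particular $D_\pm1=0$) and a symmetric positive definite, diagonal mass matrix $M\in\mathbb R^{\mathtt{ndof}\times\mathtt{ndof}}$ such that $MD_+=-D_-^TM$. The functions $g$ and $g'$ are applied componentwise to vectors in $\mathbb R^{\mathtt{ndof}}$. *)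

theory Defs
  imports "HOL-Analysis.Analysis"
begin

definition symmetric_matrix :: "real ^ 'n ^ 'n \<Rightarrow> bool" where
  "symmetric_matrix A \<longleftrightarrow> transpose A = A"

definition positive_definite_matrix :: "real ^ 'n ^ 'n \<Rightarrow> bool" where
  "positive_definite_matrix A \<longleftrightarrow> (\<forall>x. x \<noteq> 0 \<longrightarrow> 0 < x \<bullet> (A *v x))"

definition diagonal_matrix :: "real ^ 'n ^ 'n \<Rightarrow> bool" where
  "diagonal_matrix A \<longleftrightarrow> (\<forall>i j. i \<noteq> j \<longrightarrow> A $ i $ j = 0)"

text \<open>
  The number of degrees of freedom is the cardinality of the index type. The library constant
  \<^term>\<open>1 :: real ^ 'n\<close> is the vector all of whose entries are 1. For a single pair of matrices,
  consistency with the first derivative is expressed by the requirement that constants are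
  differentiated exactly; no order of accuracy beyond that is assumed.
\<close>

definition periodic_upwind_SBP ::
    "real ^ 'n ^ 'n \<Rightarrow> real ^ 'n ^ 'n \<Rightarrow> real ^ 'n ^ 'n \<Rightarrow> bool" where
  "periodic_upwind_SBP Dp Dm M \<longleftrightarrow>
     Dp *v 1 = 0 \<and> Dm *v 1 = 0 \<and>
     symmetric_matrix M \<and> positive_definite_matrix M \<and> diagonal_matrix M \<and>
     M ** Dp = - (transpose Dm ** M)"

definition componentwise :: "(real \<Rightarrow> real) \<Rightarrow> real ^ 'n \<Rightarrow> real ^ 'n" where
  "componentwise f v = (\<chi> i. f (v $ i))"

definition double_well :: "real \<Rightarrow> real" where
  "double_well c = 1 / 4 * (c\<^sup>2 - 1)\<^sup>2"

definition discrete_energy :: "real \<Rightarrow> real ^ 'n ^ 'n \<Rightarrow> real ^ 'n ^ 'n \<Rightarrow> real ^ 'n \<Rightarrow> real" where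
  "discrete_energy \<gamma> M D2 c =
     1 \<bullet> (M *v componentwise double_well c) - \<gamma> / 2 * (c \<bullet> ((M ** D2) *v c))"

definition cahn_hilliard_rhs :: "real \<Rightarrow> real ^ 'n ^ 'n \<Rightarrow> real ^ 'n \<Rightarrow> real ^ 'n" where
  "cahn_hilliard_rhs \<gamma> D2 c = D2 *v (componentwise (deriv double_well) c - \<gamma> *\<^sub>R (D2 *v c))"

text \<open>
  Derivatives are taken within the time interval, hence are one-sided at endpoints belonging to it.
  The interval is nondegenerate, so these derivatives are unique.
\<close>

definition cahn_hilliard_solution ::
    "real \<Rightarrow> real ^ 'n ^ 'n \<Rightarrow> real set \<Rightarrow> (real \<Rightarrow> real ^ 'n) \<Rightarrow> bool" where
  "cahn_hilliard_solution \<gamma> D2 T c \<longleftrightarrow>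
     is_interval T \<and> interior T \<noteq> {} \<and>
     (\<forall>t\<in>T. (c has_vector_derivative cahn_hilliard_rhs \<gamma> D2 (c t)) (at t within T))"

end

theory Submission
  imports Defs
begin

text \<open>
  Summation by parts turns the bilinear form \<open>x\<^sup>T M D\<^sub>2 y\<close> into
  \<open>-(B x)\<^sup>T M (B y)\<close>, where \<open>B\<close> is the factor of \<open>D\<^sub>2\<close> applied first; it is therefore symmetric
  and negative semidefinite. By symmetry the energy has gradient \<open>M w\<close> with the chemical
  potential \<open>w = g'(c) - \<gamma> D\<^sub>2 c\<close>, so along a solution its derivative is \<open>w\<^sup>T M D\<^sub>2 w\<close>.
\<close>

lemma inner_matrix_vector_transpose:
  fixes A :: "real ^ 'n ^ 'm"
  shows "x \<bullet> (A *v y) = (transpose A *v x) \<bullet> y"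
  by (simp add: dot_lmul_matrix)

lemma inner_symmetric_matrix:
  assumes "symmetric_matrix M"
  shows "x \<bullet> (M *v y) = (M *v x) \<bullet> y"
  using assms inner_matrix_vector_transpose[of x M y] by (simp add: symmetric_matrix_def)

text \<open>Off-diagonal terms vanish, leaving a weighted sum over entries. In this form the
  nonlinear part of the energy can be differentiated entry by entry.\<close>

lemma inner_diagonal_matrix:
  assumes "diagonal_matrix M"
  shows "x \<bullet> (M *v y) = (\<Sum>i\<in>UNIV. M $ i $ i * (x $ i * y $ i))"
proof -
  have "(\<Sum>j\<in>UNIV. M $ i $ j * y $ j) = M $ i $ i * y $ i" for i
  proof -
    have "(\<Sum>j\<in>UNIV. M $ i $ j * y $ j) = (\<Sum>j\<in>{i}. M $ i $ j * y $ j)"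
      using assms by (intro sum.mono_neutral_right) (auto simp: diagonal_matrix_def)
    then show ?thesis by simp
  qed
  then show ?thesis
    by (simp add: inner_vec_def matrix_vector_mult_def algebra_simps)
qed

lemma positive_definite_matrix_nonneg:
  assumes "positive_definite_matrix M"
  shows "0 \<le> x \<bullet> (M *v x)"
  using assms by (cases "x = 0") (auto simp: positive_definite_matrix_def less_imp_le)

text \<open>The hypothesis trades \<open>A\<close> for the transpose of \<open>B\<close> to the left
  of \<open>M\<close>, and the inner product then moves that transpose onto \<open>x\<close> as
  \<open>B\<close>. Keeping \<open>A\<close> and \<open>B\<close> generic serves both choices of
  \<open>D2\<close>.\<close>

lemma summation_by_parts_second_derivative:
  fixes M A B :: "real ^ 'n ^ 'n"
  assumes "M ** A = - (transpose B ** M)"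
  shows "x \<bullet> ((M ** (A ** B)) *v y) = - ((B *v x) \<bullet> (M *v (B *v y)))"
proof -
  have neg: "(- X) *v z = - (X *v z)" for X :: "real ^ 'n ^ 'n" and z
    using matrix_vector_mult_diff_rdistrib[of 0 X z] by simp
  have "(M ** (A ** B)) *v y = (- (transpose B ** M)) *v (B *v y)"
    by (simp add: matrix_mul_assoc assms[symmetric] matrix_vector_mul_assoc)
  also have "\<dots> = - (transpose B *v (M *v (B *v y)))"
    unfolding neg by (simp add: matrix_vector_mul_assoc matrix_mul_assoc)
  finally show ?thesis
    using inner_matrix_vector_transpose[of x "transpose B" "M *v (B *v y)"]
    by (simp only: transpose_transpose inner_minus_right)
qed

text \<open>Transposing the summation-by-parts relation exchanges the two operators, because
  \<open>M\<close> is symmetric. Hence the two orders in \<open>D2\<close> need only one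
  argument.\<close>

lemma periodic_upwind_SBP_swap:
  assumes "periodic_upwind_SBP Dp Dm M"
  shows "periodic_upwind_SBP Dm Dp M"
proof -
  have tneg: "transpose (- X) = - transpose X" for X :: "real ^ 'n ^ 'n"
    by (simp add: transpose_def vec_eq_iff)
  have "transpose (M ** Dp) = transpose (- (transpose Dm ** M))"
    using assms by (simp add: periodic_upwind_SBP_def)
  then have "transpose Dp ** M = - (M ** Dm)"
    using assms
    by (simp add: periodic_upwind_SBP_def symmetric_matrix_def matrix_transpose_mul tneg)
  then show ?thesis
    using assms by (simp add: periodic_upwind_SBP_def)
qed

lemma double_well_has_derivative: "(double_well has_real_derivative deriv double_well x) (at x)"
proof -
  have "(double_well has_real_derivative (x\<^sup>2 - 1) * x) (at x)"
    unfolding double_well_def by (auto intro!: derivative_eq_intros)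
  then show ?thesis
    by (simp add: DERIV_imp_deriv)
qed

lemma discrete_energy_has_derivative:
  fixes M D2 :: "real ^ 'n ^ 'n"
  assumes M: "symmetric_matrix M" "diagonal_matrix M"
    and sym: "\<And>x y. x \<bullet> ((M ** D2) *v y) = y \<bullet> ((M ** D2) *v x)"
    and c: "(c has_vector_derivative c') (at t within T)"
  shows "((\<lambda>s. discrete_energy \<gamma> M D2 (c s)) has_real_derivative
    (componentwise (deriv double_well) (c t) - \<gamma> *\<^sub>R (D2 *v c t)) \<bullet> (M *v c')) (at t within T)"
proof -
  have comp: "((\<lambda>s. c s $ i) has_real_derivative c' $ i) (at t within T)" for i
    using bounded_linear.has_vector_derivative[OF bounded_linear_vec_nth c]
    by (simp add: has_real_derivative_iff_has_vector_derivative)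
  have "((\<lambda>s. double_well (c s $ i)) has_real_derivative deriv double_well (c t $ i) * c' $ i)
      (at t within T)" for i
    by (rule DERIV_chain2[OF double_well_has_derivative comp])
  \<comment> \<open>Both inner products become sums weighted by \<open>M $ i $ i\<close>, so the
    chain rule in each entry suffices.\<close>
  then have pot: "((\<lambda>s. 1 \<bullet> (M *v componentwise double_well (c s))) has_real_derivative
      componentwise (deriv double_well) (c t) \<bullet> (M *v c')) (at t within T)"
    unfolding inner_diagonal_matrix[OF M(2)]
    by (auto simp: componentwise_def intro!: DERIV_sum DERIV_cmult)
  have "((\<lambda>s. (M ** D2) *v c s) has_vector_derivative (M ** D2) *v c') (at t within T)"
    by (rule bounded_linear.has_vector_derivative[OF matrix_vector_mul_bounded_linear c])
  \<comment> \<open>The product rule gives two terms that agree by \<open>sym\<close>; the resulting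
    factor 2 cancels the 1/2 in the energy.\<close>
  from bounded_bilinear.has_vector_derivative[OF bounded_bilinear_inner c this]
  have "((\<lambda>s. c s \<bullet> ((M ** D2) *v c s)) has_real_derivative 2 * (c' \<bullet> ((M ** D2) *v c t)))
      (at t within T)"
    by (simp add: has_real_derivative_iff_has_vector_derivative sym[of "c t" c'])
  from DERIV_diff[OF pot DERIV_cmult[OF this, of "\<gamma> / 2"]]
  have "((\<lambda>s. discrete_energy \<gamma> M D2 (c s)) has_real_derivative
      componentwise (deriv double_well) (c t) \<bullet> (M *v c') - \<gamma> * (c' \<bullet> ((M ** D2) *v c t)))
      (at t within T)"
    by (simp add: discrete_energy_def)
  \<comment> \<open>Symmetry of \<open>M\<close> moves it onto \<open>c'\<close>, so that both
    contributions pair with the same vector \<open>M *v c'\<close>.\<close>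
  moreover have "c' \<bullet> ((M ** D2) *v c t) = (D2 *v c t) \<bullet> (M *v c')"
    by (simp add: matrix_vector_mul_assoc[symmetric] inner_symmetric_matrix[OF M(1)]
        inner_commute)
  ultimately show ?thesis
    by (simp add: inner_diff_left)
qed

theorem lemma15:
  fixes \<gamma> :: real and Dp Dm M D2 :: "real ^ 'n ^ 'n"
    and T :: "real set" and c :: "real \<Rightarrow> real ^ 'n"
  assumes "\<gamma> > 0"
    and "periodic_upwind_SBP Dp Dm M"
    and "D2 = Dp ** Dm \<or> D2 = Dm ** Dp"
    and "cahn_hilliard_solution \<gamma> D2 T c"
  shows "\<forall>t\<in>T. \<exists>e. ((\<lambda>s. discrete_energy \<gamma> M D2 (c s)) has_real_derivative e) (at t within T) \<and> e \<le> 0"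
proof
  fix t assume "t \<in> T"
  obtain A B where D2: "D2 = A ** B" and "periodic_upwind_SBP A B M"
    using assms(2,3) periodic_upwind_SBP_swap by blast
  then have M: "symmetric_matrix M" "positive_definite_matrix M" "diagonal_matrix M"
    and sbp: "M ** A = - (transpose B ** M)"
    by (auto simp: periodic_upwind_SBP_def)
  have form: "x \<bullet> ((M ** D2) *v y) = - ((B *v x) \<bullet> (M *v (B *v y)))" for x y
    unfolding D2 by (rule summation_by_parts_second_derivative[OF sbp])
  \<comment> \<open>By \<open>form\<close>, exchanging \<open>x\<close> and \<open>y\<close> only
    exchanges the arguments of the symmetric form of \<open>M\<close>.\<close>
  have sym: "x \<bullet> ((M ** D2) *v y) = y \<bullet> ((M ** D2) *v x)" for x y
    unfolding form by (metis inner_symmetric_matrix[OF M(1)] inner_commute)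
  define w where "w = componentwise (deriv double_well) (c t) - \<gamma> *\<^sub>R (D2 *v c t)"
  have "(c has_vector_derivative D2 *v w) (at t within T)"
    using assms(4) \<open>t \<in> T\<close> by (simp add: cahn_hilliard_solution_def cahn_hilliard_rhs_def w_def)
  from discrete_energy_has_derivative[OF M(1,3) sym this]
  have "((\<lambda>s. discrete_energy \<gamma> M D2 (c s)) has_real_derivative w \<bullet> (M *v (D2 *v w)))
      (at t within T)"
    by (simp add: w_def)
  \<comment> \<open>By \<open>form\<close> at \<open>x = y = w\<close>, this is minus the squared
    \<open>M\<close>-norm of \<open>B *v w\<close>.\<close>
  moreover have "w \<bullet> (M *v (D2 *v w)) \<le> 0"
    using form[of w w] positive_definite_matrix_nonneg[OF M(2), of "B *v w"]
    by (simp add: matrix_vector_mul_assoc)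
  ultimately show "\<exists>e. ((\<lambda>s. discrete_energy \<gamma> M D2 (c s)) has_real_derivative e) (at t within T)
      \<and> e \<le> 0"
    by blast
qed

end
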